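(* There is an absolute constant $C>0$ such that for every integer $n\ge 2$ there exists an $n$-vertex tournament $G$ such that every acyclic subgraph of $G$ has chromatic number at most $C\, n^{3/4}\log n$.
   Context: A tournament is an orientation of a complete graph. A subgraph of an oriented graph is acyclic if it contains no directed cycle. The chromatic number of an oriented graph is the chromatic number of its underlying undirected graph. $\log$ denotes the natural logarithm. *)

theory Defs
  imports Complex_Main "Graph_Theory.Graph_Theory"
begin

text \<open>
  The undirected graph underlying a digraph \<open>G\<close> is \<open>mk_symmetric G\<close>: as everywhere in
  Graph_Theory, an undirected graph is a symmetric digraph.
\<close>

locale oriented_graph = digraph +
  assumes asym_arcs: "asym (arcs_ends G)"

locale tournament = oriented_graph +
  assumes complete: "complete_digraph (card (verts G)) (with_proj (mk_symmetric G))"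

definition acyclic_digraph :: "('a, 'b) pre_digraph \<Rightarrow> bool" where
  "acyclic_digraph G \<longleftrightarrow> (\<nexists>p. pre_digraph.cycle G p)"

definition proper_colouring :: "('a, 'b) pre_digraph \<Rightarrow> nat \<Rightarrow> ('a \<Rightarrow> nat) \<Rightarrow> bool" where
  "proper_colouring G k c \<longleftrightarrow>
     c ` verts G \<subseteq> {..<k} \<and> (\<forall>(u, v) \<in> arcs_ends G. c u \<noteq> c v)"

text \<open>
  \<open>LEAST\<close> is unspecified if there is no proper colouring with finitely many colours; finite
  loop-free graphs always have one, see \<open>ex_proper_colouring\<close> below.
\<close>

definition chromatic_number :: "('a, 'b) pre_digraph \<Rightarrow> nat" where
  "chromatic_number G = (LEAST k. \<exists>c. proper_colouring G k c)"

definition underlying_chromatic_number :: "('a, 'b) pre_digraph \<Rightarrow> nat" where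
  "underlying_chromatic_number G = chromatic_number (with_proj (mk_symmetric G))"

lemma (in digraph) ex_proper_colouring:
  "\<exists>c. proper_colouring (with_proj (mk_symmetric G)) (card (verts G)) c"
proof -
  obtain c where "bij_betw c (verts G) {0..<card (verts G)}"
    using ex_bij_betw_finite_nat[OF finite_verts] by blast
  then have "c ` verts G = {..<card (verts G)}" and "inj_on c (verts G)"
    by (auto simp: bij_betw_def)
  then have "proper_colouring (with_proj (mk_symmetric G)) (card (verts G)) c"
    by (auto simp: proper_colouring_def mk_symmetric_def inj_on_eq_iff dest: no_loops)
  then show ?thesis by blast
qed

end

theory Submission
  imports Defs "HOL-Library.FuncSet"
begin

text \<open>
  Place the vertices \<open>v < n\<close> on a grid of width about \<open>\<surd>n\<close>. For each of \<open>O(log n)\<close> slopes, the lines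
  of that slope partition the grid into \<open>O(\<surd>n log n)\<close> parts, and two vertices share at most one line.
  Give every slope an independent random order of the vertices and orient each pair on a
  common line by the order of its slope.

  An acyclic subgraph respects some ordering \<open>s\<close>, so a set is independent in it as soon as it lies
  on a line and the random order of this line reverses \<open>s\<close>. For a fixed set \<open>U\<close> of \<open>u\<close> vertices and
  fixed \<open>s\<close>, if no line contains a reversed set of more than \<open>k\<close> vertices of \<open>U\<close>, then each line
  splits into \<open>k\<close> chains on which the random order agrees with \<open>s\<close>; counting shows that this has
  probability at most \<open>2^-u\<close> per slope when \<open>k\<close> is of order \<open>\<surd>(u / M)\<close>, where \<open>M\<close> is the number of lines
  of a slope. With \<open>4 log n\<close> slopes this beats the union bound over all \<open>(U, s)\<close>. Removing reversed
  sets greedily then colours the acyclic subgraph with \<open>O(\<surd>(n M))\<close> colours.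
\<close>

section \<open>Counting monotone functions\<close>

text \<open>A monotone function on a chain is determined by its fibre sizes, so stars and bars applies.\<close>

lemma card_total_monotone_functions:
  fixes le :: "'a \<Rightarrow> 'a \<Rightarrow> bool"
  assumes fin: "finite U"
    and total: "\<And>v w. v \<in> U \<Longrightarrow> w \<in> U \<Longrightarrow> v \<noteq> w \<Longrightarrow> le v w \<or> le w v"
  shows "card {h \<in> U \<rightarrow>\<^sub>E {..<R}. \<forall>v\<in>U. \<forall>w\<in>U. le v w \<longrightarrow> h v \<le> h w} * fact (card U)
           \<le> (card U + R) ^ card U"
proof -
  let ?H = "{h \<in> U \<rightarrow>\<^sub>E {..<R}. \<forall>v\<in>U. \<forall>w\<in>U. le v w \<longrightarrow> h v \<le> h w}"
  let ?fib = "\<lambda>h i. {v \<in> U. h v = i}"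
  define \<phi> where "\<phi> h = map (\<lambda>i. card (?fib h i)) [0..<R]" for h :: "'a \<Rightarrow> nat"
  have "inj_on \<phi> ?H"
  proof (rule inj_onI)
    fix h h' assume h: "h \<in> ?H" and h': "h' \<in> ?H" and eq: "\<phi> h = \<phi> h'"
    have fib: "card (?fib h i) = card (?fib h' i)" if "i < R" for i
      using arg_cong[OF eq, of "\<lambda>l. l ! i"] that by (simp add: \<phi>_def)
    have below: "card {v \<in> U. h v < i} = card {v \<in> U. h' v < i}" if "i \<le> R" for i
      using that
    proof (induction i)
      case (Suc i)
      have "card {v \<in> U. g v < Suc i} = card {v \<in> U. g v < i} + card (?fib g i)" for g :: "'a \<Rightarrow> nat"
      proof -
        have "{v \<in> U. g v < Suc i} = {v \<in> U. g v < i} \<union> ?fib g i" by auto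
        then show ?thesis using fin by (simp add: card_Un_disjoint disjoint_iff)
      qed
      with Suc fib[of i] show ?case by simp
    qed simp
    \<comment> \<open>Both sublevel sets are closed downwards under the total relation
      \<open>le\<close>, hence nested. They have equal size, as a sum of equal fibre sizes, so they
      coincide.\<close>
    have same: "{v \<in> U. h v < i} = {v \<in> U. h' v < i}" if "i \<le> R" for i
    proof -
      have "{v \<in> U. h v < i} \<subseteq> {v \<in> U. h' v < i} \<or> {v \<in> U. h' v < i} \<subseteq> {v \<in> U. h v < i}"
      proof (rule ccontr)
        assume "\<not> ?thesis"
        then obtain x y where x: "x \<in> U" "h x < i" "\<not> h' x < i" and y: "y \<in> U" "h' y < i" "\<not> h y < i"
          by blast
        then have "le x y \<or> le y x" using total by metis
        then have "h x \<le> h y \<and> h' x \<le> h' y \<or> h y \<le> h x \<and> h' y \<le> h' x"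
          using x(1) y(1) h h' by blast
        then show False using x(2,3) y(2,3) by linarith
      qed
      then show ?thesis
      proof
        assume "{v \<in> U. h v < i} \<subseteq> {v \<in> U. h' v < i}"
        then show ?thesis using below[OF that] fin by (intro card_subset_eq) simp_all
      next
        assume "{v \<in> U. h' v < i} \<subseteq> {v \<in> U. h v < i}"
        then have "{v \<in> U. h' v < i} = {v \<in> U. h v < i}"
          using below[OF that] fin by (intro card_subset_eq) simp_all
        then show ?thesis ..
      qed
    qed
    show "h = h'"
    proof
      fix v
      show "h v = h' v"
      proof (cases "v \<in> U")
        case True
        then have "h v < R" "h' v < R" using h h' by (auto simp: PiE_iff)
        then show ?thesis
          using same[of "Suc (h v)"] same[of "Suc (h' v)"] True by (auto simp: set_eq_iff less_Suc_eq_le intro!: antisym)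
      next
        case False
        then show ?thesis using h h' by (auto simp: PiE_iff extensional_def)
      qed
    qed
  qed
  moreover have "\<phi> ` ?H \<subseteq> {l. length l = R \<and> sum_list l = card U}"
  proof
    fix l assume "l \<in> \<phi> ` ?H"
    then obtain h where h: "h \<in> ?H" and l: "l = \<phi> h" by auto
    have "sum_list l = (\<Sum>i<R. card (?fib h i))"
      by (simp add: l \<phi>_def interv_sum_list_conv_sum_set_nat atLeast0LessThan)
    also have "\<dots> = card (\<Union>i<R. ?fib h i)"
      using fin by (subst card_UN_disjoint) auto
    also have "(\<Union>i<R. ?fib h i) = U" using h by (auto simp: PiE_iff)
    finally show "l \<in> {l. length l = R \<and> sum_list l = card U}" by (simp add: l \<phi>_def)
  qed
  moreover have "finite {l :: nat list. length l = R \<and> sum_list l = card U}"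
  proof (rule finite_subset)
    show "{l :: nat list. length l = R \<and> sum_list l = card U} \<subseteq> {l. set l \<subseteq> {..card U} \<and> length l = R}"
      by (auto dest: member_le_sum_list)
  qed (simp add: finite_lists_length_eq)
  ultimately have "card ?H \<le> card {l :: nat list. length l = R \<and> sum_list l = card U}"
    by (rule card_inj_on_le)
  then have "card ?H * fact (card U) \<le> ((card U + R - 1) choose card U) * fact (card U)"
    by (simp add: card_length_sum_list)
  also have "\<dots> \<le> (card U + R - 1) ^ card U" by (rule binomial_fact_pow)
  also have "\<dots> \<le> (card U + R) ^ card U" by (rule power_mono) auto
  finally show ?thesis .
qed

text \<open>Shifting \<open>f\<close> by \<open>K\<close> times the class number gives every class
  its own block of \<open>K\<close> values. Classwise monotone functions thus inject into the
  functions with \<open>r * K\<close> values that are monotone along the lexicographic order by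
  \<open>c\<close>, then \<open>s\<close>.\<close>

lemma card_classwise_monotone_functions:
  fixes s c :: "'a \<Rightarrow> nat"
  assumes fin: "finite U" and inj: "inj_on s U" and c: "c ` U \<subseteq> {..<r}"
  shows "card {f \<in> U \<rightarrow>\<^sub>E {..<K}. \<forall>v\<in>U. \<forall>w\<in>U. c v = c w \<and> s v < s w \<longrightarrow> f v \<le> f w} * fact (card U)
           \<le> (card U + r * K) ^ card U"
proof -
  let ?F = "{f \<in> U \<rightarrow>\<^sub>E {..<K}. \<forall>v\<in>U. \<forall>w\<in>U. c v = c w \<and> s v < s w \<longrightarrow> f v \<le> f w}"
  define le where "le v w \<longleftrightarrow> c v < c w \<or> c v = c w \<and> s v < s w" for v w
  let ?H = "{h \<in> U \<rightarrow>\<^sub>E {..<r * K}. \<forall>v\<in>U. \<forall>w\<in>U. le v w \<longrightarrow> h v \<le> h w}"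
  define \<psi> where "\<psi> f = (\<lambda>v\<in>U. c v * K + f v)" for f
  have block: "c v * K + f v < Suc (c v) * K" if "f \<in> U \<rightarrow>\<^sub>E {..<K}" "v \<in> U" for f v
    using that by (auto simp: PiE_iff)
  have "inj_on \<psi> ?F"
  proof (rule inj_onI)
    fix f f' assume f: "f \<in> ?F" and f': "f' \<in> ?F" and eq: "\<psi> f = \<psi> f'"
    show "f = f'"
    proof
      fix v show "f v = f' v"
        using fun_cong[OF eq, of v] f f' by (cases "v \<in> U") (auto simp: \<psi>_def PiE_iff extensional_def)
    qed
  qed
  moreover have "\<psi> ` ?F \<subseteq> ?H"
  proof (rule image_subsetI)
    fix f assume f: "f \<in> ?F"
    have "c v * K + f v < r * K" if "v \<in> U" for v
    proof -
      have "Suc (c v) * K \<le> r * K" using c that by (intro mult_le_mono1) auto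
      with block[of f v] f that show ?thesis by auto
    qed
    moreover have "c v * K + f v \<le> c w * K + f w" if "v \<in> U" "w \<in> U" "le v w" for v w
    proof (cases "c v < c w")
      case True
      then have "Suc (c v) * K \<le> c w * K" by (intro mult_le_mono1) auto
      with block[of f v] f that show ?thesis by auto
    next
      case False
      with that f show ?thesis by (auto simp: le_def)
    qed
    ultimately show "\<psi> f \<in> ?H" by (auto simp: \<psi>_def)
  qed
  moreover have "finite ?H" using fin by (simp add: finite_PiE)
  ultimately have "card ?F \<le> card ?H" by (rule card_inj_on_le)
  moreover have "card ?H * fact (card U) \<le> (card U + r * K) ^ card U"
    using fin
  proof (rule card_total_monotone_functions)
    fix v w assume "v \<in> U" "w \<in> U" "v \<noteq> w"
    then have "s v \<noteq> s w" using inj by (auto dest: inj_onD)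
    then show "le v w \<or> le w v" by (auto simp: le_def)
  qed
  ultimately show ?thesis by (meson le_trans mult_le_mono1)
qed

section \<open>Reversed sets on lines\<close>

definition reversing :: "('a \<Rightarrow> nat) \<Rightarrow> ('a \<Rightarrow> nat) \<Rightarrow> 'a set \<Rightarrow> bool" where
  "reversing s p S \<longleftrightarrow> (\<forall>v\<in>S. \<forall>w\<in>S. s v < s w \<longrightarrow> p w < p v)"

definition collinear :: "('a \<Rightarrow> nat) \<Rightarrow> 'a set \<Rightarrow> bool" where
  "collinear l S \<longleftrightarrow> (\<forall>v\<in>S. \<forall>w\<in>S. l v = l w)"

text \<open>The label of \<open>v\<close> is the size of the longest reversed chain on its line that ends in \<open>v\<close>.\<close>

lemma monotone_labelling:
  fixes s p l :: "'a \<Rightarrow> nat"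
  assumes fin: "finite U" and inj: "inj_on s U"
    and short: "\<And>S. S \<subseteq> U \<Longrightarrow> collinear l S \<Longrightarrow> reversing s p S \<Longrightarrow> card S \<le> k"
  obtains g where "g \<in> U \<rightarrow>\<^sub>E {..<k}"
    and "\<And>v w. v \<in> U \<Longrightarrow> w \<in> U \<Longrightarrow> l v = l w \<Longrightarrow> g v = g w \<Longrightarrow> s v < s w \<Longrightarrow> p v \<le> p w"
proof -
  define Ch where "Ch v = {S. S \<subseteq> U \<and> v \<in> S \<and> collinear l S \<and> reversing s p S \<and> (\<forall>w\<in>S. s w \<le> s v)}" for v
  define m where "m v = Max (card ` Ch v)" for v
  have finCh: "finite (Ch v)" for v
    by (rule finite_subset[of _ "Pow U"]) (use fin in \<open>auto simp: Ch_def\<close>)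
  have single: "{v} \<in> Ch v" if "v \<in> U" for v
    using that by (auto simp: Ch_def collinear_def reversing_def)
  have m_ge: "card S \<le> m v" if "S \<in> Ch v" for S v
    unfolding m_def using that finCh by (intro Max_ge) auto
  have m_attained: "\<exists>S\<in>Ch v. card S = m v" if "v \<in> U" for v
  proof -
    have "m v \<in> card ` Ch v" unfolding m_def using finCh single[OF that] by (intro Max_in) auto
    then show ?thesis by auto
  qed
  have m_pos: "1 \<le> m v" if "v \<in> U" for v
    using m_ge[OF single[OF that]] by simp
  have m_le: "m v \<le> k" if "v \<in> U" for v
    using m_attained[OF that] short unfolding Ch_def by (metis (mono_tags, lifting) mem_Collect_eq)
  have m_less: "m v < m w" if "v \<in> U" "w \<in> U" "l v = l w" "s v < s w" "p w < p v" for v w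
  proof -
    obtain S where S: "S \<in> Ch v" "card S = m v" using m_attained[OF \<open>v \<in> U\<close>] by blast
    \<comment> \<open>In a reversed chain the element that is last in \<open>s\<close> is least in
      \<open>p\<close>. So \<open>w\<close>, beyond \<open>v\<close> in \<open>s\<close> and below
      \<open>v\<close> in \<open>p\<close>, extends every chain that ends in
      \<open>v\<close>.\<close>
    have low: "s x < s w \<and> p w < p x \<and> l x = l w" if "x \<in> S" for x
    proof -
      have "S \<subseteq> U" "collinear l S" "reversing s p S" "\<forall>w\<in>S. s w \<le> s v" "v \<in> S"
        using S(1) unfolding Ch_def by auto
      then have x: "x \<in> U" "s x \<le> s v" "l x = l v" and rev: "s x < s v \<longrightarrow> p v < p x"
        using that unfolding collinear_def reversing_def by blast+
      have "p v \<le> p x"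
      proof (cases "x = v")
        case False
        then have "s x < s v" using x \<open>v \<in> U\<close> inj by (metis inj_onD le_neq_implies_less)
        then show ?thesis using rev by simp
      qed simp
      with x \<open>l v = l w\<close> \<open>s v < s w\<close> \<open>p w < p v\<close> show ?thesis by auto
    qed
    have "insert w S \<in> Ch w"
      using S(1) low \<open>w \<in> U\<close> by (fastforce simp: Ch_def collinear_def reversing_def)
    moreover have "w \<notin> S" using low by blast
    moreover have "finite S" using S(1) fin by (auto simp: Ch_def intro: finite_subset)
    ultimately show ?thesis using m_ge[of "insert w S" w] S(2) by simp
  qed
  show ?thesis
  proof
    \<comment> \<open>Chain sizes run from 1 to \<open>k\<close>, hence the shift by one; since they
      are positive, truncated subtraction loses nothing.\<close>
    show "(\<lambda>v\<in>U. m v - 1) \<in> U \<rightarrow>\<^sub>E {..<k}"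
      using m_pos m_le by (fastforce simp: PiE_iff)
    show "p v \<le> p w" if "v \<in> U" "w \<in> U" "l v = l w" "(\<lambda>v\<in>U. m v - 1) v = (\<lambda>v\<in>U. m v - 1) w" "s v < s w" for v w
      using m_less[of v w] m_pos[of v] m_pos[of w] that by (fastforce simp: not_le[symmetric])
  qed
qed

text \<open>The quotient of \<open>u ^ u\<close> by \<open>fact u\<close> is a single term of the
  series of \<open>exp u\<close>, and e is at most 3.\<close>

lemma power_self_le_fact: "u ^ u \<le> 3 ^ u * (fact u :: nat)"
proof -
  have "real u ^ u / fact u \<le> exp (real u)"
  proof -
    have "(\<Sum>i\<in>{u}. real u ^ i /\<^sub>R fact i) \<le> exp (real u)"
      unfolding exp_def by (rule sum_le_suminf) (auto intro: summable_exp_generic[of "real u", unfolded real_scaleR_def])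
    then show ?thesis by (simp add: field_simps)
  qed
  also have "exp (real u) = exp 1 ^ u" by (simp flip: exp_of_nat_mult)
  also have "\<dots> \<le> 3 ^ u" by (rule power_mono) (auto intro: exp_le)
  finally have "real (u ^ u) \<le> real (3 ^ u * fact u)" by (simp add: field_simps)
  then show ?thesis by linarith
qed

text \<open>
  A random function \<open>f\<close> plays the role of a random order, with ties broken by the vertex itself;
  the same key makes the rank function of an acyclic subgraph injective.
\<close>

definition order_key :: "nat \<Rightarrow> (nat \<Rightarrow> nat) \<Rightarrow> nat \<Rightarrow> nat" where
  "order_key n f v = f v * n + v"

lemma order_key_inj: "inj_on (order_key n f) {..<n}"
proof (rule inj_onI)
  fix v w assume "v \<in> {..<n}" "w \<in> {..<n}" "order_key n f v = order_key n f w"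
  then have "(f v * n + v) mod n = (f w * n + w) mod n" "v < n" "w < n"
    by (auto simp: order_key_def)
  then show "v = w" by simp
qed

lemma order_key_less:
  assumes "f v < f w" "v < n"
  shows "order_key n f v < order_key n f w"
proof -
  have "order_key n f v < Suc (f v) * n" using assms by (simp add: order_key_def)
  also have "\<dots> \<le> f w * n" using assms by (intro mult_le_mono1) auto
  finally show ?thesis by (simp add: order_key_def)
qed

text \<open>Here \<open>l\<close> assigns to each vertex its line, for one fixed slope.\<close>

definition bad :: "nat \<Rightarrow> nat \<Rightarrow> (nat \<Rightarrow> nat) \<Rightarrow> (nat \<Rightarrow> nat) \<Rightarrow> nat set \<Rightarrow> (nat \<Rightarrow> nat) \<Rightarrow> bool" where
  "bad n k l s U f \<longleftrightarrow>
     (\<forall>S\<subseteq>U. collinear l S \<longrightarrow> reversing s (order_key n f) S \<longrightarrow> card S \<le> k)"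

section \<open>The probability of being bad at one slope\<close>

text \<open>Allows functions and orderings to be restricted to \<open>U\<close>, where they can be
  counted.\<close>

lemma bad_cong:
  assumes "\<And>v. v \<in> U \<Longrightarrow> f v = f' v" "\<And>v. v \<in> U \<Longrightarrow> s v = s' v"
  shows "bad n k l s U f \<longleftrightarrow> bad n k l s' U f'"
proof -
  have "reversing s (order_key n f) S \<longleftrightarrow> reversing s' (order_key n f') S" if "S \<subseteq> U" for S
    using assms that by (auto simp: reversing_def order_key_def subset_iff)
  then show ?thesis by (auto simp: bad_def)
qed

text \<open>A bad \<open>f\<close> comes with a labelling \<open>g\<close> by \<open>k\<close>
  labels, obtained from \<open>monotone_labelling\<close>. Once \<open>g\<close> is fixed, in
  \<open>k ^ card U\<close> ways, \<open>f\<close> is monotone along \<open>s\<close> on each of the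
  at most \<open>M * k\<close> classes of equal line and label, and such \<open>f\<close> have been
  counted.\<close>

lemma card_bad_fact_le:
  assumes U: "U \<subseteq> {..<n}" and inj: "inj_on s U" and l: "l ` U \<subseteq> {..<M}"
  shows "card {f \<in> U \<rightarrow>\<^sub>E {..<K}. bad n k l s U f} * fact (card U)
           \<le> (k * (card U + M * k * K)) ^ card U"
proof -
  have fin: "finite U" using U finite_subset by blast
  define c where "c g v = l v * k + g v" for g v
  define A where "A g = {f \<in> U \<rightarrow>\<^sub>E {..<K}. \<forall>v\<in>U. \<forall>w\<in>U. c g v = c g w \<and> s v < s w \<longrightarrow> f v \<le> f w}" for g
  let ?G = "U \<rightarrow>\<^sub>E {..<k}"
  have finG: "finite ?G" using fin by (simp add: finite_PiE)
  have finA: "finite (A g)" for g unfolding A_def using fin by (simp add: finite_PiE)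
  have "{f \<in> U \<rightarrow>\<^sub>E {..<K}. bad n k l s U f} \<subseteq> (\<Union>g\<in>?G. A g)"
  proof
    fix f assume f: "f \<in> {f \<in> U \<rightarrow>\<^sub>E {..<K}. bad n k l s U f}"
    then obtain g where g: "g \<in> ?G"
      and mono: "\<And>v w. v \<in> U \<Longrightarrow> w \<in> U \<Longrightarrow> l v = l w \<Longrightarrow> g v = g w \<Longrightarrow> s v < s w
                   \<Longrightarrow> order_key n f v \<le> order_key n f w"
      using monotone_labelling[OF fin inj, of l "order_key n f" k] by (auto simp: bad_def)
    have "f v \<le> f w" if vw: "v \<in> U" "w \<in> U" "c g v = c g w" "s v < s w" for v w
    proof -
      have "g v < k" "g w < k" using g vw by (auto simp: PiE_iff)
      \<comment> \<open>Labels are below \<open>k\<close>, so quotient and remainder recover line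
        and label from the class number.\<close>
      moreover have "(l v * k + g v) mod k = (l w * k + g w) mod k"
        "(l v * k + g v) div k = (l w * k + g w) div k" using vw by (auto simp: c_def)
      ultimately have "l v = l w" "g v = g w" by auto
      then have "order_key n f v \<le> order_key n f w" using mono vw by blast
      then show ?thesis using order_key_less[of f w v n] vw U by (force simp: not_less[symmetric])
    qed
    then show "f \<in> (\<Union>g\<in>?G. A g)" using f g by (auto simp: A_def)
  qed
  then have "card {f \<in> U \<rightarrow>\<^sub>E {..<K}. bad n k l s U f} \<le> card (\<Union>g\<in>?G. A g)"
    using finG finA by (intro card_mono) auto
  also have "\<dots> \<le> (\<Sum>g\<in>?G. card (A g))" by (rule card_UN_le[OF finG])
  finally have "card {f \<in> U \<rightarrow>\<^sub>E {..<K}. bad n k l s U f} * fact (card U)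
      \<le> (\<Sum>g\<in>?G. card (A g)) * fact (card U)"
    by (rule mult_le_mono1)
  also have "\<dots> = (\<Sum>g\<in>?G. card (A g) * fact (card U))" by (rule sum_distrib_right)
  also have "\<dots> \<le> (\<Sum>g\<in>?G. (card U + M * k * K) ^ card U)"
  proof (rule sum_mono)
    fix g assume g: "g \<in> ?G"
    have "c g ` U \<subseteq> {..<M * k}"
    proof (rule image_subsetI)
      fix v assume v: "v \<in> U"
      then have "c g v < Suc (l v) * k" using g by (auto simp: c_def PiE_iff)
      also have "\<dots> \<le> M * k" using l v by (intro mult_le_mono1) auto
      finally show "c g v \<in> {..<M * k}" by simp
    qed
    then show "card (A g) * fact (card U) \<le> (card U + M * k * K) ^ card U"
      unfolding A_def by (rule card_classwise_monotone_functions[OF fin inj])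
  qed
  also have "\<dots> = (k * (card U + M * k * K)) ^ card U"
    using fin by (simp add: card_PiE power_mult_distrib)
  finally show ?thesis .
qed

text \<open>Read as a probability: a uniform \<open>f\<close> is bad with probability at most
  \<open>2^(-u)\<close>, where \<open>u = card U\<close>. The constant 12 is a product of three
  factors: 2 for absorbing \<open>u\<close> into \<open>M * k * K\<close> (when
  \<open>k > 0\<close>), 3 from \<open>u ^ u \<le> 3 ^ u * fact u\<close>, and 2 for the
  target.\<close>

lemma card_bad_le:
  assumes U: "U \<subseteq> {..<n}" "U \<noteq> {}" and inj: "inj_on s U" and l: "l ` U \<subseteq> {..<M}"
    and k: "12 * M * k\<^sup>2 \<le> card U" and K: "card U \<le> K"
  shows "card {f \<in> U \<rightarrow>\<^sub>E {..<K}. bad n k l s U f} * 2 ^ card U \<le> K ^ card U"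
proof -
  let ?u = "card U" and ?B = "card {f \<in> U \<rightarrow>\<^sub>E {..<K}. bad n k l s U f}"
  have pos: "0 < ?u" using U finite_subset by (fastforce simp: card_gt_0_iff)
  have fact_bound: "?B * fact ?u \<le> (k * (?u + M * k * K)) ^ ?u"
    by (rule card_bad_fact_le[OF U(1) inj l])
  have "k * (?u + M * k * K) \<le> 2 * M * k\<^sup>2 * K"
  proof (cases "k = 0")
    case False
    have "M \<noteq> 0" using U(2) l by auto
    with False have "1 * K \<le> M * k * K" by (intro mult_le_mono1) auto
    then have "k * (?u + M * k * K) \<le> k * (M * k * K + M * k * K)"
      using K by (intro mult_le_mono2) linarith
    then show ?thesis by (simp add: power2_eq_square algebra_simps)
  qed simp
  then have "?B * fact ?u \<le> (2 * M * k\<^sup>2 * K) ^ ?u"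
    using fact_bound by (meson le_trans power_mono zero_le)
  moreover have "(?B * 2 ^ ?u) * ?u ^ ?u \<le> (?B * 2 ^ ?u) * (3 ^ ?u * fact ?u)"
    by (intro mult_le_mono2 power_self_le_fact)
  ultimately have "(?B * 2 ^ ?u) * ?u ^ ?u \<le> 6 ^ ?u * (2 * M * k\<^sup>2 * K) ^ ?u"
  proof -
    assume *: "?B * fact ?u \<le> (2 * M * k\<^sup>2 * K) ^ ?u"
      and **: "(?B * 2 ^ ?u) * ?u ^ ?u \<le> (?B * 2 ^ ?u) * (3 ^ ?u * fact ?u)"
    have "(?B * 2 ^ ?u) * (3 ^ ?u * fact ?u) = (2 * 3) ^ ?u * (?B * fact ?u)"
      by (simp only: power_mult_distrib ac_simps)
    also have "\<dots> \<le> (2 * 3) ^ ?u * (2 * M * k\<^sup>2 * K) ^ ?u" using * by (rule mult_le_mono2)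
    also have "2 * 3 = (6 :: nat)" by simp
    finally show ?thesis using ** by (rule le_trans[rotated])
  qed
  also have "\<dots> = (6 * (2 * M * k\<^sup>2 * K)) ^ ?u" by (simp only: power_mult_distrib)
  also have "6 * (2 * M * k\<^sup>2 * K) = 12 * M * k\<^sup>2 * K" by simp
  also have "(12 * M * k\<^sup>2 * K) ^ ?u \<le> (?u * K) ^ ?u" using k by (intro power_mono mult_le_mono1) auto
  also have "\<dots> = K ^ ?u * ?u ^ ?u" by (simp add: power_mult_distrib)
  finally show ?thesis using pos by simp
qed

text \<open>A function consists of its restrictions to \<open>U\<close> and to the complement.
  Badness constrains the first only, and the second contributes the power of
  \<open>K\<close>.\<close>

lemma card_bad_extend:
  assumes U: "U \<subseteq> {..<n}"
  shows "card {f \<in> {..<n} \<rightarrow>\<^sub>E {..<K}. bad n k l s U f}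
           \<le> card {f \<in> U \<rightarrow>\<^sub>E {..<K}. bad n k l s U f} * K ^ (n - card U)"
proof -
  let ?X = "{f \<in> {..<n} \<rightarrow>\<^sub>E {..<K}. bad n k l s U f}"
  let ?Y = "{f \<in> U \<rightarrow>\<^sub>E {..<K}. bad n k l s U f}"
  let ?Z = "({..<n} - U) \<rightarrow>\<^sub>E {..<K}"
  define \<rho> where "\<rho> f = (restrict f U, restrict f ({..<n} - U))" for f :: "nat \<Rightarrow> nat"
  have fin: "finite U" using U finite_subset by blast
  have "inj_on \<rho> ?X"
  proof (rule inj_onI)
    fix f g assume f: "f \<in> ?X" and g: "g \<in> ?X" and eq: "\<rho> f = \<rho> g"
    show "f = g"
    proof
      fix v
      have "restrict f U v = restrict g U v" "restrict f ({..<n} - U) v = restrict g ({..<n} - U) v"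
        using eq by (auto simp: \<rho>_def)
      then show "f v = g v"
        using f g by (cases "v < n"; cases "v \<in> U") (auto simp: PiE_iff extensional_def)
    qed
  qed
  moreover have "\<rho> ` ?X \<subseteq> ?Y \<times> ?Z"
  proof (rule image_subsetI)
    fix f assume f: "f \<in> ?X"
    have "bad n k l s U (restrict f U) \<longleftrightarrow> bad n k l s U f" by (rule bad_cong) auto
    then show "\<rho> f \<in> ?Y \<times> ?Z" using f U by (auto simp: \<rho>_def PiE_iff)
  qed
  moreover have "finite (?Y \<times> ?Z)" using fin by (simp add: finite_PiE)
  ultimately have "card ?X \<le> card (?Y \<times> ?Z)" by (rule card_inj_on_le)
  also have "\<dots> = card ?Y * K ^ (n - card U)"
    using U fin by (simp add: card_cartesian_product card_PiE card_Diff_subset)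
  finally show ?thesis .
qed

section \<open>The union bound\<close>

text \<open>There are at most \<open>n^(3u) \<le> 2^(3Tu)\<close> pairs of a \<open>u\<close>-set
  and an ordering, and each is bad at all \<open>4 * T\<close> independent slopes with probability
  at most \<open>2^(-4Tu)\<close>. Size \<open>u\<close> thus contributes at most
  \<open>2^(-Tu) \<le> 2^(-u)\<close>, and over \<open>1 \<le> u \<le> n\<close> these sum to less
  than 1.\<close>

lemma exists_good_functions:
  fixes l :: "nat \<Rightarrow> nat \<Rightarrow> nat" and \<kappa> :: "nat \<Rightarrow> nat"
  assumes T: "n \<le> 2 ^ T" "1 \<le> T" "1 \<le> n"
    and l: "\<And>a v. a < 4 * T \<Longrightarrow> v < n \<Longrightarrow> l a v < M"
    and \<kappa>: "\<And>u. 12 * M * (\<kappa> u)\<^sup>2 \<le> u"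
  obtains F where "\<And>U s. U \<subseteq> {..<n} \<Longrightarrow> U \<noteq> {} \<Longrightarrow> inj_on s U \<Longrightarrow> s ` U \<subseteq> {..<n * n} \<Longrightarrow>
       \<exists>a<4 * T. \<not> bad n (\<kappa> (card U)) (l a) s U (F a)"
proof -
  let ?L = "4 * T"
  define \<Omega> where "\<Omega> = {..<?L} \<rightarrow>\<^sub>E ({..<n} \<rightarrow>\<^sub>E {..<n})"
  define W where "W = (n ^ n) ^ ?L"
  \<comment> \<open>The tuples that are bad for \<open>(U, s)\<close> at every slope form a product
    set, so their number is a product over slopes; this is the independence of the slopes.\<close>
  define D where "D U s = (\<Pi>\<^sub>E a\<in>{..<?L}. {f \<in> {..<n} \<rightarrow>\<^sub>E {..<n}. bad n (\<kappa> (card U)) (l a) s U f})" for U s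
  \<comment> \<open>The range below \<open>n * n\<close> is that of \<open>order_key n h\<close> on
    the vertices for ranks \<open>h\<close> below \<open>n\<close>.\<close>
  define P where "P u = (SIGMA U : {U. U \<subseteq> {..<n} \<and> card U = u}. {s \<in> U \<rightarrow>\<^sub>E {..<n * n}. inj_on s U})" for u
  have cardO: "card \<Omega> = W" by (simp add: \<Omega>_def W_def card_PiE)
  have finO: "finite \<Omega>" by (simp add: \<Omega>_def finite_PiE)
  have finP: "finite (P u)" for u
    unfolding P_def by (intro finite_SigmaI) (auto intro: finite_subset finite_PiE)
  have cardP: "card (P u) \<le> 2 ^ (3 * T * u)" if "u \<le> n" for u
  proof -
    have "P u \<subseteq> (SIGMA U : {U. U \<subseteq> {..<n} \<and> card U = u}. U \<rightarrow>\<^sub>E {..<n * n})" by (auto simp: P_def)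
    moreover have "finite (SIGMA U : {U. U \<subseteq> {..<n} \<and> card U = u}. U \<rightarrow>\<^sub>E {..<n * n})"
      by (intro finite_SigmaI) (auto intro: finite_subset finite_PiE)
    ultimately have "card (P u) \<le> card (SIGMA U : {U. U \<subseteq> {..<n} \<and> card U = u}. U \<rightarrow>\<^sub>E {..<n * n})"
      by (intro card_mono)
    also have "\<dots> = (\<Sum>U\<in>{U. U \<subseteq> {..<n} \<and> card U = u}. card (U \<rightarrow>\<^sub>E {..<n * n}))"
      by (intro card_SigmaI) (auto intro: finite_subset finite_PiE)
    also have "\<dots> = (\<Sum>U\<in>{U. U \<subseteq> {..<n} \<and> card U = u}. (n * n) ^ u)"
      by (intro sum.cong refl) (auto simp: card_PiE finite_subset)
    also have "\<dots> = (n choose u) * (n * n) ^ u" by (simp add: n_subsets)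
    also have "\<dots> \<le> n ^ u * (n * n) ^ u" using that by (intro mult_le_mono1 binomial_le_pow)
    also have "\<dots> = n ^ (3 * u)" by (simp add: power_mult power_mult_distrib power3_eq_cube)
    also have "\<dots> \<le> (2 ^ T) ^ (3 * u)" using T(1) by (intro power_mono) auto
    also have "\<dots> = 2 ^ (3 * T * u)" by (simp flip: power_mult add: ac_simps)
    finally show ?thesis .
  qed
  have cardD: "card (D U s) * 2 ^ (?L * u) \<le> W" if "(U, s) \<in> P u" "1 \<le> u" for U s u
  proof -
    have U: "U \<subseteq> {..<n}" "card U = u" "inj_on s U" "U \<noteq> {}" using that by (auto simp: P_def)
    then have "u \<le> n" using card_mono[of "{..<n}" U] by simp
    have one: "card {f \<in> {..<n} \<rightarrow>\<^sub>E {..<n}. bad n (\<kappa> (card U)) (l a) s U f} * 2 ^ u \<le> n ^ n"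
      if "a < ?L" for a
    proof -
      have "card {f \<in> U \<rightarrow>\<^sub>E {..<n}. bad n (\<kappa> (card U)) (l a) s U f} * 2 ^ card U \<le> n ^ card U"
        using U \<open>u \<le> n\<close> \<kappa> l that by (intro card_bad_le[where M = M]) auto
      then have "card {f \<in> U \<rightarrow>\<^sub>E {..<n}. bad n (\<kappa> (card U)) (l a) s U f} * 2 ^ u * n ^ (n - u) \<le> n ^ u * n ^ (n - u)"
        using U by (intro mult_le_mono1) auto
      also have "\<dots> = n ^ n" using \<open>u \<le> n\<close> by (simp flip: power_add)
      finally have "card {f \<in> U \<rightarrow>\<^sub>E {..<n}. bad n (\<kappa> (card U)) (l a) s U f} * n ^ (n - u) * 2 ^ u \<le> n ^ n"
        by (simp only: ac_simps)
      moreover have "card {f \<in> {..<n} \<rightarrow>\<^sub>E {..<n}. bad n (\<kappa> (card U)) (l a) s U f}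
          \<le> card {f \<in> U \<rightarrow>\<^sub>E {..<n}. bad n (\<kappa> (card U)) (l a) s U f} * n ^ (n - u)"
        using card_bad_extend[OF U(1), of n "\<kappa> (card U)" "l a" s] unfolding U(2) .
      ultimately show ?thesis by (meson le_trans mult_le_mono1)
    qed
    have "card (D U s) * 2 ^ (?L * u)
        = (\<Prod>a<?L. card {f \<in> {..<n} \<rightarrow>\<^sub>E {..<n}. bad n (\<kappa> (card U)) (l a) s U f} * 2 ^ u)"
      unfolding D_def prod.distrib by (simp add: card_PiE power_mult[symmetric] mult.commute)
    also have "\<dots> \<le> (\<Prod>a<?L. n ^ n)" using one by (intro prod_mono) auto
    finally show ?thesis by (simp add: W_def)
  qed
  have layer: "card (\<Union>(U, s)\<in>P u. D U s) * 2 ^ u \<le> W" if u: "1 \<le> u" "u \<le> n" for u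
  proof -
    have "card (\<Union>(U, s)\<in>P u. D U s) \<le> (\<Sum>x\<in>P u. card (case x of (U, s) \<Rightarrow> D U s))"
      by (rule card_UN_le[OF finP])
    then have "card (\<Union>(U, s)\<in>P u. D U s) * 2 ^ (?L * u)
        \<le> (\<Sum>x\<in>P u. card (case x of (U, s) \<Rightarrow> D U s) * 2 ^ (?L * u))"
      unfolding sum_distrib_right[symmetric] by (rule mult_le_mono1)
    also have "\<dots> \<le> (\<Sum>x\<in>P u. W)" using cardD u by (intro sum_mono) auto
    also have "\<dots> \<le> 2 ^ (3 * T * u) * W" using cardP[OF u(2)] by simp
    \<comment> \<open>Of the exponent \<open>4 * T * u\<close>, the part \<open>3 * T * u\<close>
      pays for the number of pairs.\<close>
    finally have "2 ^ (3 * T * u) * (card (\<Union>(U, s)\<in>P u. D U s) * 2 ^ (T * u)) \<le> 2 ^ (3 * T * u) * W"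
      by (simp add: power_add[symmetric] algebra_simps)
    then have "card (\<Union>(U, s)\<in>P u. D U s) * 2 ^ (T * u) \<le> W" by simp
    moreover have "(2::nat) ^ u \<le> 2 ^ (T * u)" using T(2) by (intro power_increasing) auto
    ultimately show ?thesis by (meson le_trans mult_le_mono2)
  qed
  define E where "E = (\<Union>u\<in>{1..n}. \<Union>(U, s)\<in>P u. D U s)"
  have "real (card E) \<le> (\<Sum>u=1..n. real (card (\<Union>(U, s)\<in>P u. D U s)))"
    unfolding E_def of_nat_sum[symmetric] of_nat_le_iff by (rule card_UN_le) simp
  also have "\<dots> \<le> (\<Sum>u=1..n. real W * (1 / 2) ^ u)"
  proof (rule sum_mono)
    fix u assume "u \<in> {1..n}"
    then have "real (card (\<Union>(U, s)\<in>P u. D U s) * 2 ^ u) \<le> real W"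
      using layer[of u] by (simp only: of_nat_le_iff atLeastAtMost_iff)
    then show "real (card (\<Union>(U, s)\<in>P u. D U s)) \<le> real W * (1 / 2) ^ u"
      by (simp add: power_one_over field_simps)
  qed
  also have "\<dots> = real W * (1 - (1 / 2) ^ n)"
    unfolding sum_distrib_left[symmetric] by (induction n) (auto simp: field_simps)
  \<comment> \<open>The geometric sum misses 1 by \<open>(1 / 2) ^ n\<close>, so strictly fewer than
    all tuples are excluded.\<close>
  also have "\<dots> < real W" using T(3) by (simp add: W_def)
  finally have "card E < card \<Omega>" by (simp add: cardO)
  then have "\<not> \<Omega> \<subseteq> E"
  proof -
    have "D U s \<subseteq> \<Omega>" for U s unfolding D_def \<Omega>_def by (rule PiE_mono) auto
    then have "E \<subseteq> \<Omega>" unfolding E_def by blast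
    then show ?thesis using \<open>card E < card \<Omega>\<close> by (metis less_irrefl subset_antisym)
  qed
  then obtain F where F: "F \<in> \<Omega>" "F \<notin> E" by blast
  show ?thesis
  proof
    fix U s assume U: "U \<subseteq> {..<n}" "U \<noteq> {}" and s: "inj_on s U" "s ` U \<subseteq> {..<n * n}"
    have "finite U" using U finite_subset by blast
    then have u: "card U \<in> {1..n}"
      using U card_mono[of "{..<n}" U] by (simp add: Suc_le_eq card_gt_0_iff)
    \<comment> \<open>\<open>P\<close> holds extensional orderings only, so \<open>s\<close> is
      replaced by its restriction.\<close>
    have "(U, restrict s U) \<in> P (card U)" using U s by (auto simp: P_def inj_on_def)
    then have "F \<notin> D U (restrict s U)" using F(2) u unfolding E_def by blast
    then obtain a where a: "a < ?L" "\<not> bad n (\<kappa> (card U)) (l a) (restrict s U) U (F a)"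
      using F(1) by (fastforce simp: D_def \<Omega>_def PiE_iff)
    moreover have "bad n (\<kappa> (card U)) (l a) (restrict s U) U (F a) \<longleftrightarrow> bad n (\<kappa> (card U)) (l a) s U (F a)"
      by (rule bad_cong) auto
    ultimately show "\<exists>a<?L. \<not> bad n (\<kappa> (card U)) (l a) s U (F a)" by blast
  qed
qed

section \<open>From reversed sets to colourings\<close>

text \<open>Give \<open>S\<close> one colour and recurse on \<open>U - S\<close>. With
  \<open>r = sqrt (A * card U)\<close>, the size of \<open>S\<close> is at least
  \<open>r / A\<close>, so \<open>r^2\<close> drops by at least \<open>r\<close> and
  \<open>r\<close> itself by at least 1/2. Hence \<open>2 * r\<close> colours suffice.\<close>

lemma greedy_colouring:
  fixes A :: real and ok :: "'a set \<Rightarrow> bool"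
  assumes A: "0 < A" and fin: "finite U"
    and large: "\<And>V. V \<subseteq> U \<Longrightarrow> V \<noteq> {} \<Longrightarrow> \<exists>S\<subseteq>V. ok S \<and> sqrt (real (card V) / A) \<le> real (card S)"
  shows "\<exists>m c. c ` U \<subseteq> {..<m::nat} \<and> real m \<le> 2 * sqrt (A * real (card U)) \<and>
           (\<forall>i<m. ok {v \<in> U. c v = i})"
  using fin large
proof (induction "card U" arbitrary: U rule: less_induct)
  case less
  show ?case
  proof (cases "U = {}")
    case True
    then show ?thesis by (intro exI[of _ 0]) auto
  next
    case False
    let ?u = "real (card U)"
    have u: "1 \<le> ?u" using False \<open>finite U\<close> by (simp add: Suc_le_eq card_gt_0_iff)
    obtain S where S: "S \<subseteq> U" "ok S" "sqrt (?u / A) \<le> real (card S)" using less.prems(2)[of U] False by auto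
    have "0 < sqrt (?u / A)" using A u by simp
    then have "0 < card S" using S(3) by linarith
    have finS: "finite S" using S(1) \<open>finite U\<close> finite_subset by blast
    have cardD: "card (U - S) = card U - card S" "card S \<le> card U"
      using S(1) finS \<open>finite U\<close> by (auto simp: card_Diff_subset card_mono)
    then have "card (U - S) < card U" using \<open>0 < card S\<close> by linarith
    then have "\<exists>m c. c ` (U - S) \<subseteq> {..<m::nat} \<and> real m \<le> 2 * sqrt (A * real (card (U - S))) \<and>
        (\<forall>i<m. ok {v \<in> U - S. c v = i})"
    proof (rule less.hyps)
      fix V assume "V \<subseteq> U - S" "V \<noteq> {}"
      then show "\<exists>S\<subseteq>V. ok S \<and> sqrt (real (card V) / A) \<le> real (card S)"
        using less.prems(2)[of V] by blast
    qed (use \<open>finite U\<close> in simp)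
    then obtain m c where c: "c ` (U - S) \<subseteq> {..<m::nat}" "real m \<le> 2 * sqrt (A * real (card (U - S)))"
        "\<And>i. i < m \<Longrightarrow> ok {v \<in> U - S. c v = i}"
      by blast
    let ?r = "sqrt (A * ?u)"
    have "?r = A * sqrt (?u / A)"
    proof -
      have "?r = sqrt (A\<^sup>2 * (?u / A))" using A by (simp add: power2_eq_square)
      also have "\<dots> = A * sqrt (?u / A)" using A by (simp only: real_sqrt_mult real_sqrt_abs)
      finally show ?thesis .
    qed
    then have rS: "?r \<le> A * real (card S)" using S(3) A by simp
    \<comment> \<open>As \<open>S\<close> is no larger than \<open>U\<close>,
      \<open>r \<le> A * card U = r^2\<close>, which forces \<open>r \<ge> 1\<close> and makes
      \<open>r - 1 / 2\<close> nonnegative.\<close>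
    have "real (card S) \<le> ?u" using cardD by simp
    then have "?r \<le> A * ?u" using rS A by (meson mult_left_mono less_imp_le order_trans)
    then have "?r * 1 \<le> ?r * ?r" using A by simp
    then have "1 \<le> ?r" by (rule mult_left_le_imp_le) (use A u in simp)
    \<comment> \<open>\<open>A * card (U - S)\<close> is at most \<open>r^2 - r\<close>, which lies
      below \<open>(r - 1 / 2)^2\<close>.\<close>
    have "sqrt (A * real (card (U - S))) \<le> ?r - 1 / 2"
    proof (rule real_le_lsqrt)
      show "A * real (card (U - S)) \<le> (?r - 1 / 2)\<^sup>2"
        using rS cardD A u by (simp add: power2_diff of_nat_diff algebra_simps add_increasing2)
    qed (use \<open>1 \<le> ?r\<close> in linarith)
    then have m: "real (Suc m) \<le> 2 * ?r" using c(2) by simp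
    define c' where "c' v = (if v \<in> S then m else c v)" for v
    have "{v \<in> U. c' v = i} = (if i = m then S else {v \<in> U - S. c v = i})" if "i < Suc m" for i
      using that c(1) S(1) by (auto simp: c'_def)
    then have "ok {v \<in> U. c' v = i}" if "i < Suc m" for i
      using that c(3)[of i] S(2) by (cases "i = m") (simp_all del: mem_Collect_eq)
    moreover have "c' ` U \<subseteq> {..<Suc m}" using c(1) by (auto simp: c'_def less_Suc_eq)
    ultimately show ?thesis using m by blast
  qed
qed

text \<open>Each pair on a common line is oriented along the random order of its slope, and
  \<open>sep\<close> makes that slope unique. The second property is the failure of badness for the
  ordering given by \<open>h\<close>: a large set on one line, whose random order reverses
  \<open>h\<close>.\<close>

lemma exists_tournament_relation:
  fixes l :: "nat \<Rightarrow> nat \<Rightarrow> nat"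
  assumes T: "n \<le> 2 ^ T" "1 \<le> T" "1 \<le> n"
    and l: "\<And>a v. a < 4 * T \<Longrightarrow> v < n \<Longrightarrow> l a v < M"
    and sep: "\<And>v w a b. v < n \<Longrightarrow> w < n \<Longrightarrow> v \<noteq> w \<Longrightarrow> a < 4 * T \<Longrightarrow> b < 4 * T \<Longrightarrow>
                l a v = l a w \<Longrightarrow> l b v = l b w \<Longrightarrow> a = b"
  obtains E :: "nat \<Rightarrow> nat \<Rightarrow> bool"
  where "\<And>v w. v < n \<Longrightarrow> w < n \<Longrightarrow> v \<noteq> w \<Longrightarrow> E v w \<longleftrightarrow> \<not> E w v"
    and "\<And>(h :: nat \<Rightarrow> nat) U. U \<subseteq> {..<n} \<Longrightarrow> U \<noteq> {} \<Longrightarrow> h ` U \<subseteq> {..<n} \<Longrightarrow>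
           \<exists>S\<subseteq>U. sqrt (real (card U) / (12 * real M)) \<le> real (card S) \<and>
                (\<forall>v\<in>S. \<forall>w\<in>S. h v < h w \<longrightarrow> \<not> E v w)"
proof -
  \<comment> \<open>The largest threshold that the union bound admits. Rounding down costs nothing,
    since a set with more than \<open>\<kappa> u\<close> elements already has at least
    \<open>sqrt (u / (12 * M))\<close>.\<close>
  define \<kappa> where "\<kappa> u = nat \<lfloor>sqrt (real u / (12 * real M))\<rfloor>" for u
  have "0 < M" using l[of 0 0] T by auto
  have \<kappa>: "12 * M * (\<kappa> u)\<^sup>2 \<le> u" for u
  proof -
    have "real (\<kappa> u) \<le> sqrt (real u / (12 * real M))" by (simp add: \<kappa>_def)
    then have "(real (\<kappa> u))\<^sup>2 \<le> (sqrt (real u / (12 * real M)))\<^sup>2" by (intro power_mono) auto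
    then have "real (12 * M * (\<kappa> u)\<^sup>2) \<le> real u" using \<open>0 < M\<close> by (simp add: field_simps)
    then show ?thesis by linarith
  qed
  obtain F where F: "\<And>U s. U \<subseteq> {..<n} \<Longrightarrow> U \<noteq> {} \<Longrightarrow> inj_on s U \<Longrightarrow> s ` U \<subseteq> {..<n * n} \<Longrightarrow>
       \<exists>a<4 * T. \<not> bad n (\<kappa> (card U)) (l a) s U (F a)"
  proof (rule exists_good_functions[of n T l M \<kappa>, OF T])
    show "l a v < M" if "a < 4 * T" "v < n" for a v using that by (rule l)
    show "12 * M * (\<kappa> u)\<^sup>2 \<le> u" for u by (rule \<kappa>)
  qed (rule that)
  define p where "p a = order_key n (F a)" for a
  \<comment> \<open>Pairs on no common line get an arbitrary orientation, here the usual order; a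
    reversed set lies on one line and contains no such pair.\<close>
  define E where "E v w \<longleftrightarrow> (\<exists>a<4 * T. l a v = l a w \<and> p a v < p a w) \<or>
      (\<forall>a<4 * T. l a v \<noteq> l a w) \<and> v < w" for v w
  have E_line: "E v w \<longleftrightarrow> p a v < p a w"
    if "v < n" "w < n" "v \<noteq> w" "a < 4 * T" "l a v = l a w" for v w a
    using that sep[OF that(1-3)] unfolding E_def by blast
  show ?thesis
  proof
    fix v w assume vw: "v < n" "w < n" "v \<noteq> w"
    show "E v w \<longleftrightarrow> \<not> E w v"
    proof (cases "\<exists>a<4 * T. l a v = l a w")
      case True
      then obtain a where a: "a < 4 * T" "l a v = l a w" by blast
      have "p a v \<noteq> p a w" using vw inj_onD[OF order_key_inj, of n "F a" v w] by (auto simp: p_def)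
      then show ?thesis using E_line[of v w a] E_line[of w v a] vw a by auto
    next
      case False
      then show ?thesis using vw unfolding E_def by (metis linorder_less_linear order_less_asym)
    qed
  next
    fix h :: "nat \<Rightarrow> nat" and U assume U: "U \<subseteq> {..<n}" "U \<noteq> {}" and h: "h ` U \<subseteq> {..<n}"
    define s where "s = order_key n h"
    have "inj_on s U" unfolding s_def using order_key_inj U(1) by (rule inj_on_subset)
    moreover have "s ` U \<subseteq> {..<n * n}"
    proof (rule image_subsetI)
      fix v assume v: "v \<in> U"
      then have "s v < Suc (h v) * n" using U by (auto simp: s_def order_key_def)
      also have "\<dots> \<le> n * n" using h v by (intro mult_le_mono1) auto
      finally show "s v \<in> {..<n * n}" by simp
    qed
    ultimately obtain a where a: "a < 4 * T" "\<not> bad n (\<kappa> (card U)) (l a) s U (F a)"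
      using F[OF U] by blast
    then obtain S where S: "S \<subseteq> U" "collinear (l a) S" "reversing s (p a) S"
      and card: "\<kappa> (card U) < card S"
      unfolding bad_def p_def by auto
    have "\<not> E v w" if "v \<in> S" "w \<in> S" "h v < h w" for v w
    proof -
      have vw: "v < n" "w < n" "v \<noteq> w" using that S(1) U(1) by auto
      have "s v < s w" unfolding s_def using that(3) vw(1) by (rule order_key_less)
      then have "p a w < p a v" using S(3) that unfolding reversing_def by blast
      moreover have "l a v = l a w" using S(2) that unfolding collinear_def by blast
      ultimately show ?thesis using E_line[OF vw a(1)] by simp
    qed
    moreover have "sqrt (real (card U) / (12 * real M)) \<le> real (card S)"
      using card unfolding \<kappa>_def by linarith
    ultimately show "\<exists>S\<subseteq>U. sqrt (real (card U) / (12 * real M)) \<le> real (card S) \<and>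
        (\<forall>v\<in>S. \<forall>w\<in>S. h v < h w \<longrightarrow> \<not> E v w)" using S(1) by blast
  qed
qed

section \<open>Acyclic digraphs and their ranks\<close>

lemma in_parcs_mk_symmetric_iff:
  "(v, w) \<in> parcs (mk_symmetric H) \<longleftrightarrow> (v, w) \<in> arcs_ends H \<or> (w, v) \<in> arcs_ends H"
  by (auto simp: parcs_mk_symmetric arcs_ends_conv)

text \<open>The rank of a vertex is the number of its proper ancestors.\<close>

lemma acyclic_digraph_rank:
  assumes "wf_digraph H" "finite (verts H)" "acyclic_digraph H"
  obtains h :: "'a \<Rightarrow> nat" where "h ` verts H \<subseteq> {..<card (verts H)}"
    and "\<And>v w. (v, w) \<in> arcs_ends H \<Longrightarrow> h v < h w"
proof -
  interpret wf_digraph H by fact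
  have irrefl: "(v, v) \<notin> (arcs_ends H)\<^sup>+" for v
  proof
    assume "(v, v) \<in> (arcs_ends H)\<^sup>+"
    then obtain p where "awalk v p v" "p \<noteq> []" by (auto simp: reachable1_awalk)
    then have "closed_w p" by (auto simp: closed_w_def)
    then show False using closed_w_imp_cycle assms(3) by (auto simp: acyclic_digraph_def)
  qed
  let ?D = "\<lambda>v. {w. (w, v) \<in> (arcs_ends H)\<^sup>+}"
  have sub: "?D v \<subseteq> verts H" for v by (auto dest: reachable1_in_verts)
  have fin: "finite (?D v)" for v using sub assms(2) by (rule finite_subset)
  show ?thesis
  proof
    show "(\<lambda>v. card (?D v)) ` verts H \<subseteq> {..<card (verts H)}"
    proof (rule image_subsetI)
      fix v assume "v \<in> verts H"
      then have "?D v \<subset> verts H" using sub irrefl by blast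
      then show "card (?D v) \<in> {..<card (verts H)}" using assms(2) by (simp add: psubset_card_mono)
    qed
    fix v w assume vw: "(v, w) \<in> arcs_ends H"
    \<comment> \<open>Ancestors accumulate along an arc, and \<open>v\<close> itself is new among
      those of \<open>w\<close>, because acyclicity keeps it from being its own ancestor.\<close>
    have "?D v \<subseteq> ?D w" using vw by (auto intro: trancl_into_trancl)
    moreover have "v \<in> ?D w" "v \<notin> ?D v" using vw irrefl by auto
    ultimately have "?D v \<subset> ?D w" by blast
    then show "card (?D v) < card (?D w)" using fin by (rule psubset_card_mono[rotated])
  qed
qed

section \<open>Grid lines and numerical estimates\<close>

text \<open>The vertex \<open>v\<close> is the grid point in row \<open>v div q\<close> and column
  \<open>v mod q\<close>, and the sum indexes its line of slope \<open>-a\<close>. Points that share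
  lines of two different slopes satisfy two independent linear equations, so they coincide.\<close>

lemma grid_lines_meet_once:
  fixes q v w a b :: nat
  assumes "v \<noteq> w" and a: "v div q + a * (v mod q) = w div q + a * (w mod q)"
    and b: "v div q + b * (v mod q) = w div q + b * (w mod q)"
  shows "a = b"
proof (rule ccontr)
  assume "a \<noteq> b"
  have "(int a - int b) * (int (v mod q) - int (w mod q)) = 0"
    using arg_cong[OF a, of int] arg_cong[OF b, of int] by (simp add: algebra_simps)
  with \<open>a \<noteq> b\<close> have "v mod q = w mod q" by simp
  with a have "v div q = w div q" by simp
  with \<open>v mod q = w mod q\<close> \<open>v \<noteq> w\<close> show False by (metis div_mult_mod_eq)
qed

text \<open>Lets bounded terms be absorbed into multiples of \<open>ln n\<close> from
  \<open>n = 2\<close> on.\<close>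

lemma ln_ge_half:
  assumes "2 \<le> n"
  shows "1 / 2 \<le> ln (real n)"
proof -
  have "(exp (1 / 2 :: real))\<^sup>2 = exp 1" by (simp flip: exp_of_nat_mult)
  also have "exp 1 \<le> (2 :: real)\<^sup>2" using exp_le by simp
  finally have "exp (1 / 2 :: real) \<le> 2" by (rule power2_le_imp_le) simp
  then have "exp (1 / 2) \<le> real n" using assms by linarith
  then show ?thesis using assms by (subst ln_ge_iff) auto
qed

text \<open>With \<open>y = ln n\<close>, squaring reduces the claim to
  \<open>48 * 22 * y \<le> 46^2 * y^2\<close>. Since \<open>y \<ge> 1 / 2\<close>, it is enough that
  \<open>46^2 = 2116\<close> is at least \<open>2 * 1056 = 2112\<close>; 46 is the least integer
  with this property.\<close>

lemma colour_count_bound: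
  fixes x :: real
  assumes n: "2 \<le> n" and M: "real M \<le> 22 * ln (real n) * sqrt (real n)"
    and x: "0 \<le> x" "x \<le> 2 * sqrt (12 * real M * real n)"
  shows "x \<le> 46 * real n powr (3/4) * ln (real n)"
proof (rule power2_le_imp_le)
  let ?n = "real n" and ?y = "ln (real n)"
  have y: "1 / 2 \<le> ?y" using n by (rule ln_ge_half)
  have pw: "(?n powr (3/4))\<^sup>2 = sqrt ?n * ?n"
  proof -
    have "(?n powr (3/4))\<^sup>2 = ?n powr (1/2 + 1)" by (simp add: power2_eq_square flip: powr_add)
    also have "\<dots> = ?n powr (1/2) * ?n powr 1" by (rule powr_add)
    finally show ?thesis using n by (simp add: powr_half_sqrt)
  qed
  have "x\<^sup>2 \<le> (2 * sqrt (12 * real M * ?n))\<^sup>2" using x by (intro power_mono) auto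
  also have "\<dots> = 48 * real M * ?n" by (simp add: power_mult_distrib)
  also have "\<dots> \<le> 48 * (22 * ?y * sqrt ?n) * ?n" using M by (intro mult_right_mono mult_left_mono) auto
  also have "\<dots> = 1056 * ?y * (sqrt ?n * ?n)" by simp
  also have "\<dots> \<le> (2116 * ?y * ?y) * (sqrt ?n * ?n)" using y by (intro mult_right_mono) auto
  also have "\<dots> = (46 * ?n powr (3/4) * ?y)\<^sup>2" by (simp add: power_mult_distrib pw power2_eq_square[of ?y])
  finally show "x\<^sup>2 \<le> (46 * ?n powr (3/4) * ?y)\<^sup>2" .
  show "0 \<le> 46 * ?n powr (3/4) * ?y" using y by simp
qed

text \<open>Width \<open>q\<close> about \<open>sqrt n\<close> makes both sides of the grid of order
  \<open>sqrt n\<close>. As the slopes are below \<open>4 * T\<close> with \<open>T\<close> about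
  \<open>log 2 n\<close>, the line indices stay of order \<open>sqrt n * ln n\<close>.\<close>

lemma grid_parameters:
  fixes n :: nat
  assumes n: "2 \<le> n"
  obtains T M q :: nat where "n \<le> 2 ^ T" "1 \<le> T"
    "\<And>a v. a < 4 * T \<Longrightarrow> v < n \<Longrightarrow> v div q + a * (v mod q) < M"
    "real M \<le> 22 * ln (real n) * sqrt (real n)"
proof
  define q where "q = nat \<lfloor>sqrt (real n)\<rfloor>"
  define T where "T = nat \<lceil>log 2 (real n)\<rceil>"
  \<comment> \<open>Largest row index plus largest slope times column; the final 1 makes the bound
    strict.\<close>
  define M where "M = n div q + 4 * T * q + 1"
  have y: "1 / 2 \<le> ln (real n)" using n by (rule ln_ge_half)
  have log: "1 \<le> log 2 (real n)" using n by simp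
  have T: "log 2 (real n) \<le> real T" "real T \<le> log 2 (real n) + 1" unfolding T_def using log by linarith+
  have r: "1 \<le> sqrt (real n)" using n by simp
  have q: "real q \<le> sqrt (real n)" "sqrt (real n) < real q + 1" "1 \<le> real q"
    unfolding q_def using r by (linarith | simp)+
  show "n \<le> 2 ^ T"
  proof -
    have "real n = 2 powr log 2 (real n)" using n by simp
    also have "\<dots> \<le> 2 powr real T" using T by simp
    also have "\<dots> = real (2 ^ T)" by (simp add: powr_realpow)
    finally show ?thesis by linarith
  qed
  show "1 \<le> T" using T log by linarith
  show "v div q + a * (v mod q) < M" if "a < 4 * T" "v < n" for a v
  proof -
    have "v div q \<le> n div q" using that by (intro div_le_mono) simp
    moreover have "v mod q \<le> q" using q by simp
    then have "a * (v mod q) \<le> 4 * T * q" using that by (intro mult_le_mono) auto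
    ultimately show ?thesis by (simp add: M_def)
  qed
  show "real M \<le> 22 * ln (real n) * sqrt (real n)"
  proof -
    have "log 2 (real n) * ln 2 = ln (real n)" by (simp add: log_def)
    moreover have "log 2 (real n) * (1 / 2) \<le> log 2 (real n) * ln 2"
      using log ln_ge_half[of 2] by (intro mult_left_mono) auto
    ultimately have T3: "real T \<le> 4 * ln (real n)" using T log by linarith
    have "real (n div q) \<le> real n / real q" by (rule of_nat_div_le_of_nat)
    also have "\<dots> \<le> 2 * sqrt (real n)"
    proof -
      have "real n = sqrt (real n) * sqrt (real n)" by simp
      also have "\<dots> \<le> sqrt (real n) * (2 * real q)"
      proof (rule mult_left_mono)
        show "sqrt (real n) \<le> 2 * real q" using q by linarith
      qed simp
      finally show ?thesis using q by (simp add: divide_le_eq mult_ac)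
    qed
    finally have "real (n div q) \<le> 2 * sqrt (real n)" .
    moreover have "real T * real q \<le> (4 * ln (real n)) * sqrt (real n)"
      using T3 q y by (intro mult_mono) auto
    moreover have "(1 / 2) * sqrt (real n) \<le> ln (real n) * sqrt (real n)"
      using y r by (intro mult_right_mono) auto
    moreover have "real M = real (n div q) + 4 * (real T * real q) + 1" by (simp add: M_def)
    \<comment> \<open>In units of \<open>ln n * sqrt n\<close>, the three terms of \<open>M\<close>
      cost 4 for \<open>n div q \<le> 2 * sqrt n\<close>, 16 for \<open>4 * T * q\<close> with
      \<open>T \<le> 4 * ln n\<close>, and 2 for \<open>1 \<le> sqrt n\<close>.\<close>
    moreover have "22 * ln (real n) * sqrt (real n) = 22 * (ln (real n) * sqrt (real n))"
      "4 * ln (real n) * sqrt (real n) = 4 * (ln (real n) * sqrt (real n))" by simp_all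
    ultimately show ?thesis using r by linarith
  qed
qed

theorem theorem1p4:
  shows "\<exists>C::real. C > 0 \<and> (\<forall>n::nat. n \<ge> 2 \<longrightarrow>
           (\<exists>G :: (nat, nat \<times> nat) pre_digraph. tournament G \<and> card (verts G) = n \<and>
              (\<forall>H. subgraph H G \<and> acyclic_digraph H \<longrightarrow>
                 real (underlying_chromatic_number H) \<le> C * real n powr (3/4) * ln (real n))))"
proof (intro exI[of _ 46] conjI allI impI)
  fix n :: nat assume n: "2 \<le> n"
  obtain T M q where T: "n \<le> 2 ^ T" "1 \<le> T"
    and l: "\<And>a v. a < 4 * T \<Longrightarrow> v < n \<Longrightarrow> v div q + a * (v mod q) < M"
    and M: "real M \<le> 22 * ln (real n) * sqrt (real n)"
    by (rule grid_parameters[OF n]) (rule that)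
  have "0 < M" using l[of 0 0] T n by simp
  obtain E :: "nat \<Rightarrow> nat \<Rightarrow> bool"
    where E: "\<And>v w. v < n \<Longrightarrow> w < n \<Longrightarrow> v \<noteq> w \<Longrightarrow> E v w \<longleftrightarrow> \<not> E w v"
    and large: "\<And>(h :: nat \<Rightarrow> nat) U. U \<subseteq> {..<n} \<Longrightarrow> U \<noteq> {} \<Longrightarrow> h ` U \<subseteq> {..<n} \<Longrightarrow>
           \<exists>S\<subseteq>U. sqrt (real (card U) / (12 * real M)) \<le> real (card S) \<and>
                (\<forall>v\<in>S. \<forall>w\<in>S. h v < h w \<longrightarrow> \<not> E v w)"
  proof (rule exists_tournament_relation[OF T])
    show "1 \<le> n" using n by simp
    show "v div q + a * (v mod q) < M" if "a < 4 * T" "v < n" for a v using that by (rule l)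
    show "a = b" if "v \<noteq> w" "v div q + a * (v mod q) = w div q + a * (w mod q)"
      "v div q + b * (v mod q) = w div q + b * (w mod q)" for v w a b
      using that by (rule grid_lines_meet_once)
  qed (rule that)
  define G where "G = \<lparr>verts = {..<n}, arcs = {(v, w). v < n \<and> w < n \<and> v \<noteq> w \<and> E v w}, tail = fst, head = snd\<rparr>"
  have ends: "arcs_ends G = {(v, w). v < n \<and> w < n \<and> v \<noteq> w \<and> E v w}"
    by (auto simp: G_def arcs_ends_conv)
  have "digraph G"
  proof
    show "finite (arcs G)"
      by (rule finite_subset[of _ "{..<n} \<times> {..<n}"]) (auto simp: G_def)
  qed (auto simp: G_def arc_to_ends_def)
  then interpret digraph G .
  have "tournament G"
  proof
    show "asym (arcs_ends G)" using E by (auto simp: ends asym_iff)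
    have "(v, w) \<in> parcs (mk_symmetric G) \<longleftrightarrow> v < n \<and> w < n \<and> v \<noteq> w" for v w
      unfolding in_parcs_mk_symmetric_iff ends using E[of v w] by auto
    then have "parcs (mk_symmetric G) = {(v, w). v < n \<and> w < n \<and> v \<noteq> w}" by auto
    then show "complete_digraph (card (verts G)) (with_proj (mk_symmetric G))"
      unfolding complete_digraph_pair_def by (auto simp: G_def)
  qed
  moreover have "real (underlying_chromatic_number H) \<le> 46 * real n powr (3/4) * ln (real n)"
    if H: "subgraph H G" "acyclic_digraph H" for H
  proof -
    have verts: "verts H \<subseteq> {..<n}" and wf: "wf_digraph H" using H(1) by (auto simp: subgraph_def G_def)
    have fin: "finite (verts H)" using verts finite_subset by blast
    have card: "card (verts H) \<le> n" using card_mono[OF _ verts] by simp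
    obtain h :: "nat \<Rightarrow> nat" where h: "h ` verts H \<subseteq> {..<card (verts H)}"
      and rank: "\<And>v w. (v, w) \<in> arcs_ends H \<Longrightarrow> h v < h w"
      by (rule acyclic_digraph_rank[OF wf fin H(2)]) (rule that)
    let ?ok = "\<lambda>S. \<forall>v\<in>S. \<forall>w\<in>S. h v < h w \<longrightarrow> \<not> E v w"
    have "\<exists>S\<subseteq>V. ?ok S \<and> sqrt (real (card V) / (12 * real M)) \<le> real (card S)"
      if "V \<subseteq> verts H" "V \<noteq> {}" for V
    proof -
      have "h ` V \<subseteq> {..<card (verts H)}" using h that(1) by blast
      then have "h ` V \<subseteq> {..<n}" using card by fastforce
      moreover have "V \<subseteq> {..<n}" using that(1) verts by blast
      ultimately show ?thesis using large[of V h] that(2) by blast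
    qed
    then have "\<exists>m c. c ` verts H \<subseteq> {..<m::nat} \<and>
        real m \<le> 2 * sqrt (12 * real M * real (card (verts H))) \<and> (\<forall>i<m. ?ok {v \<in> verts H. c v = i})"
      using \<open>0 < M\<close> fin by (intro greedy_colouring) simp_all
    then obtain m c where c: "c ` verts H \<subseteq> {..<m}"
      and m: "real m \<le> 2 * sqrt (12 * real M * real (card (verts H)))"
      and ok: "\<And>i. i < m \<Longrightarrow> ?ok {v \<in> verts H. c v = i}"
      by blast
    \<comment> \<open>An arc of \<open>H\<close> is an arc of \<open>G\<close> and raises
      \<open>h\<close>, and no colour class contains both ends of such an arc.\<close>
    have "c v \<noteq> c w" if "(v, w) \<in> arcs_ends H" for v w
    proof -
      have "E v w" using that arcs_ends_mono[OF H(1)] by (auto simp: ends)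
      moreover have "v \<in> verts H" "w \<in> verts H" using that wf by (auto dest: wf_digraph.adj_in_verts)
      ultimately show ?thesis using ok[of "c v"] c rank[OF that] by auto
    qed
    then have "proper_colouring (with_proj (mk_symmetric H)) m c"
      using c by (fastforce simp: proper_colouring_def in_parcs_mk_symmetric_iff)
    then have "underlying_chromatic_number H \<le> m"
      unfolding underlying_chromatic_number_def chromatic_number_def by (blast intro: Least_le)
    moreover have "real m \<le> 46 * real n powr (3/4) * ln (real n)"
    proof (rule colour_count_bound[OF n M])
      have "sqrt (12 * real M * real (card (verts H))) \<le> sqrt (12 * real M * real n)"
        using card by (intro real_sqrt_le_mono mult_left_mono) auto
      then show "real m \<le> 2 * sqrt (12 * real M * real n)" using m by linarith
    qed simp
    ultimately show ?thesis by linarith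
  qed
  moreover have "card (verts G) = n" by (simp add: G_def)
  ultimately show "\<exists>G :: (nat, nat \<times> nat) pre_digraph. tournament G \<and> card (verts G) = n \<and>
      (\<forall>H. subgraph H G \<and> acyclic_digraph H \<longrightarrow>
         real (underlying_chromatic_number H) \<le> 46 * real n powr (3/4) * ln (real n))"
    by blast
qed simp

end
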